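(* Let $(G,d)$ be a $p$-uniformly convex space with constant $c>0$, let $D\subset G$, let $T:G\to G$ with $T(D)\subseteq D$ boundedly compact, and let $S:=\operatorname{Fix}T\cap D$ be nonempty. Assume: (i) $T$ is pointwise $\alpha$-firmly nonexpansive at all points $y\in S$ with the same constant $\bar\alpha$ on $D$; (ii) the function $\mathcal T_S(x):=\left(\tfrac2c\inf_{y\in S}\psi_T^{(p,c)}(x,y)\right)^{1/p}$ is metrically subregular for $0$ relative to $D$ on $D$ with gauge $\rho$, that is, $$d(x,\operatorname{Fix}T\cap D)\le\rho(d(Tx,x))\quad\forall x\in D,$$ where, for $\tau=\frac{c(1-\bar\alpha)}{2\bar\alpha}$, the gauge $\rho$ satisfies $$\rho\left(\left(\frac{t^p-\theta(t)^p}{\tau}\right)^{1/p}\right)=t\quad\iff\quad\theta(t)=\left(t^p-\tau(\rho^{-1}(t))^p\right)^{1/p}$$ for a function $\theta:[0,\infty)\to[0,\infty)$ with $\theta(0)=0$, $0<\theta(t)<t$ for all $t>0$, and $\sum_{j=1}^\infty\theta^{(j)}(t)<\infty$ for all $t\ge0$. Then for any $x_0\in D$ the sequence $(x_k)_{k\in\mathbb N}$ defined by $x_{k+1}:=Tx_k$ satisfies $$d(x_{k+1},\operatorname{Fix}T\cap D)\le\theta\left(d(x_k,\operatorname{Fix}T\cap D)\right)\quad\forall k\in\mathbb N.$$ Moreover, $(x_k)_{k\in\mathbb N}$ converges gauge monotonically to some $x^*\in\operatorname{Fix}T\cap D$ with rate $O(s_k(t_0))$, where $s_k(t):=\sum_{j=k}^\infty\theta^{(j)}(t)$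 and $t_0:=d(x_0,\operatorname{Fix}T\cap D)$.
   Context: Let $p\in(1,\infty)$. A metric space $(G,d)$ is $p$-uniformly convex with constant $c>0$ if it is a geodesic space and for all $x,y,z\in G$, $t\in[0,1]$: $$d(z,(1-t)x\oplus ty)^p\le(1-t)d(z,x)^p+td(z,y)^p-\tfrac c2t(1-t)d(x,y)^p,$$ where $(1-t)x\oplus ty$ is the point on the (unique) geodesic joining $x$ and $y$ at distance $t\,d(x,y)$ from $x$. $\operatorname{Fix}T=\{x:Tx=x\}$; $d(x,S)=\inf_{z\in S}d(x,z)$. $\psi_T^{(p,c)}(x,y)=\tfrac c2\left(d(Tx,x)^p+d(Ty,y)^p+d(Tx,Ty)^p+d(x,y)^p-d(Tx,y)^p-d(x,Ty)^p\right)$. $T$ is pointwise $\alpha$-firmly nonexpansive at $y\in D$ on $D$ with constant $\alpha\in(0,1)$ if $d(Tx,Ty)^p\le d(x,y)^p-\tfrac{1-\alpha}{\alpha}\psi_T^{(p,c)}(x,y)$ for all $x\in D$. A gauge function $\rho:[0,\infty)\to[0,\infty)$ is continuous, strictly increasing, with $\rho(0)=0$ and $\lim_{t\to\infty}\rho(t)=\infty$. $\theta^{(j)}$ is the $j$-fold composition of $\theta$. A function $\mathcal T:G\to[0,\infty]$ is metrically subregular for $0$ relative to $D$ on $D$ with gauge $\rho$ if $d(x,\mathcal T^{-1}(0)\cap D)\le\rho(\mathcal T(x))$ for all $x\in D$ with $\rho(\mathcal T(x))>0$. A subset $A\subseteq G$ is boundedly compact if every bounded sequence in $A$ has a subsequence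 converging to a point of $A$. A sequence $(x_k)$ is gauge monotone with respect to a nonempty set $S$ with rate $\mu$ if $d(x_{k+1},S)\le\mu(d(x_k,S))$ for all $k$, where $\mu:[0,\infty)\to[0,\infty)$ is continuous with $\mu(0)=0$ and $\mu(t_1)<\mu(t_2)\le t_2$ whenever $0\le t_1<t_2$. It converges gauge monotonically to $x^*$ with rate $s_k(t)=\sum_{j=k}^\infty\mu^{(j)}(t)$ if it is gauge monotone with gauge $\mu$ satisfying $\sum_{j=1}^\infty\mu^{(j)}(t)<\infty$ for all $t\ge0$, and there is a constant $a>0$ with $d(x_k,x^* )\le a\,s_k(t)$ for all $k\in\mathbb N$; here this is meant with $\mu=\theta$, the set $\operatorname{Fix}T\cap D$, and $t=t_0$.
   Formalization: The "Moreover" part (gauge monotone convergence) is stated only for strictly increasing θ: the definition of gauge monotone with μ = θ requires this, and the listed hypotheses on θ do not imply it. The first inequality carries no extra condition. *)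

theory Defs
  imports "HOL-Analysis.Analysis"
begin

text \<open>Geodesics are parametrised on the unit interval with constant speed, so the point at
  distance \<open>t * dist x y\<close> from \<open>x\<close> is \<open>\<gamma> t\<close>.\<close>

definition geodesic_in :: "'a::metric_space set \<Rightarrow> (real \<Rightarrow> 'a) \<Rightarrow> 'a \<Rightarrow> 'a \<Rightarrow> bool" where
  "geodesic_in G \<gamma> x y \<longleftrightarrow>
     \<gamma> ` {0..1} \<subseteq> G \<and> \<gamma> 0 = x \<and> \<gamma> 1 = y \<and>
     (\<forall>s\<in>{0..1}. \<forall>t\<in>{0..1}. dist (\<gamma> s) (\<gamma> t) = \<bar>s - t\<bar> * dist x y)"

definition geodesic_space :: "'a::metric_space set \<Rightarrow> bool" where
  "geodesic_space G \<longleftrightarrow> (\<forall>x\<in>G. \<forall>y\<in>G. \<exists>\<gamma>. geodesic_in G \<gamma> x y)"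

text \<open>The convex combination \<open>(1 - t) x \<oplus> t y\<close> is rendered as the point \<open>\<gamma> t\<close> of an arbitrary
  geodesic from \<open>x\<close> to \<open>y\<close>. For \<open>p > 1\<close> and \<open>c > 0\<close> the inequality forces geodesics to be
  unique: if \<open>\<gamma> t\<close> and \<open>\<gamma>' t\<close> differed, their midpoint would be strictly closer than \<open>\<gamma> t\<close>
  to both \<open>x\<close> and \<open>y\<close>.\<close>

definition p_uniformly_convex :: "'a::metric_space set \<Rightarrow> real \<Rightarrow> real \<Rightarrow> bool" where
  "p_uniformly_convex G p c \<longleftrightarrow>
     geodesic_space G \<and>
     (\<forall>x\<in>G. \<forall>y\<in>G. \<forall>z\<in>G. \<forall>t\<in>{0..1}. \<forall>\<gamma>. geodesic_in G \<gamma> x y \<longrightarrow>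
        dist z (\<gamma> t) powr p \<le>
          (1 - t) * dist z x powr p + t * dist z y powr p
          - c / 2 * t * (1 - t) * dist x y powr p)"

definition fixed_points :: "('a \<Rightarrow> 'a) \<Rightarrow> 'a set" where
  "fixed_points T = {x. T x = x}"

definition psi :: "real \<Rightarrow> real \<Rightarrow> ('a::metric_space \<Rightarrow> 'a) \<Rightarrow> 'a \<Rightarrow> 'a \<Rightarrow> real" where
  "psi p c T x y =
     c / 2 * (dist (T x) x powr p + dist (T y) y powr p + dist (T x) (T y) powr p
              + dist x y powr p - dist (T x) y powr p - dist x (T y) powr p)"

definition pointwise_firmly_nonexpansive ::
  "real \<Rightarrow> real \<Rightarrow> real \<Rightarrow> ('a::metric_space \<Rightarrow> 'a) \<Rightarrow> 'a \<Rightarrow> 'a set \<Rightarrow> bool" where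
  "pointwise_firmly_nonexpansive p c \<alpha> T y D \<longleftrightarrow>
     0 < \<alpha> \<and> \<alpha> < 1 \<and> y \<in> D \<and>
     (\<forall>x\<in>D. dist (T x) (T y) powr p \<le> dist x y powr p - (1 - \<alpha>) / \<alpha> * psi p c T x y)"

text \<open>For \<open>y\<close> a fixed point, \<open>psi p c T x y = c / 2 * dist (T x) x powr p\<close>; hence for nonempty
  \<open>S\<close> consisting of fixed points the infimum below is finite and nonnegative, and a real-valued
  rendering loses nothing.\<close>

definition surrogate :: "real \<Rightarrow> real \<Rightarrow> ('a::metric_space \<Rightarrow> 'a) \<Rightarrow> 'a set \<Rightarrow> 'a \<Rightarrow> real" where
  "surrogate p c T S x = (2 / c * (INF y\<in>S. psi p c T x y)) powr (1 / p)"

text \<open>Functions on \<open>[0, \<infinity>)\<close> are total functions on the reals, constrained on \<open>{0..}\<close> only.\<close>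

definition gauge_function :: "(real \<Rightarrow> real) \<Rightarrow> bool" where
  "gauge_function \<rho> \<longleftrightarrow>
     continuous_on {0..} \<rho> \<and> strict_mono_on {0..} \<rho> \<and> \<rho> 0 = 0 \<and> filterlim \<rho> at_top at_top"

text \<open>The nonemptiness clause reflects that the distance to the empty set is infinite,
  whereas \<open>infdist x {} = 0\<close>.\<close>

definition metrically_subregular_for_0 ::
  "('a::metric_space \<Rightarrow> real) \<Rightarrow> 'a set \<Rightarrow> (real \<Rightarrow> real) \<Rightarrow> bool" where
  "metrically_subregular_for_0 F D \<rho> \<longleftrightarrow>
     (\<forall>x\<in>D. \<rho> (F x) > 0 \<longrightarrow>
        F -` {0} \<inter> D \<noteq> {} \<and> infdist x (F -` {0} \<inter> D) \<le> \<rho> (F x))"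

definition boundedly_compact :: "'a::metric_space set \<Rightarrow> bool" where
  "boundedly_compact A \<longleftrightarrow>
     (\<forall>u :: nat \<Rightarrow> 'a. range u \<subseteq> A \<and> bounded (range u) \<longrightarrow>
        (\<exists>l\<in>A. \<exists>r :: nat \<Rightarrow> nat. strict_mono r \<and> (u \<circ> r) \<longlonglongrightarrow> l))"

definition gauge_monotone ::
  "(nat \<Rightarrow> 'a::metric_space) \<Rightarrow> 'a set \<Rightarrow> (real \<Rightarrow> real) \<Rightarrow> bool" where
  "gauge_monotone x S \<mu> \<longleftrightarrow>
     S \<noteq> {} \<and> continuous_on {0..} \<mu> \<and> \<mu> 0 = 0 \<and>
     (\<forall>t1 t2. 0 \<le> t1 \<and> t1 < t2 \<longrightarrow> \<mu> t1 < \<mu> t2 \<and> \<mu> t2 \<le> t2) \<and>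
     (\<forall>k. infdist (x (Suc k)) S \<le> \<mu> (infdist (x k) S))"

definition tail_sum :: "(real \<Rightarrow> real) \<Rightarrow> nat \<Rightarrow> real \<Rightarrow> real" where
  "tail_sum \<mu> k t = (\<Sum>j. (\<mu> ^^ (k + j)) t)"

definition converges_gauge_monotonically ::
  "(nat \<Rightarrow> 'a::metric_space) \<Rightarrow> 'a \<Rightarrow> 'a set \<Rightarrow> (real \<Rightarrow> real) \<Rightarrow> real \<Rightarrow> bool" where
  "converges_gauge_monotonically x xstar S \<mu> t0 \<longleftrightarrow>
     gauge_monotone x S \<mu> \<and>
     (\<forall>t\<ge>0. summable (\<lambda>j. (\<mu> ^^ Suc j) t)) \<and>
     (\<exists>a>0. \<forall>k. dist (x k) xstar \<le> a * tail_sum \<mu> k t0)"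

end

theory Submission
  imports Defs
begin

text \<open>At a fixed point \<open>y\<close> the quantity \<open>psi\<close> reduces to \<open>c / 2 * d(Tx, x)^p\<close>, so firm
  nonexpansiveness reads \<open>d(Tx, y)^p \<le> d(x, y)^p - \<tau> d(Tx, x)^p\<close>, while subregularity reads
  \<open>d(x, S) \<le> \<rho> (d(Tx, x))\<close>. With \<open>t = d(x, S)\<close>, inverting \<open>\<rho>\<close> turns the latter into
  \<open>\<tau> d(Tx, x)^p \<ge> t^p - \<theta>(t)^p\<close>; inserting this in the former and taking the infimum over
  \<open>y\<close> gives \<open>d(Tx, S) \<le> \<theta>(t)\<close>. Hence \<open>d(x\<^sub>k, S) \<le> \<theta>\<^sup>k(t\<^sub>0)\<close>, and since
  \<open>d(x\<^sub>k, Tx\<^sub>k) \<le> 2 d(x\<^sub>k, S)\<close> by quasi-nonexpansiveness, the step lengths are dominated by a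
  convergent series. Bounded compactness provides a cluster point, which lies in \<open>S\<close> because
  \<open>S\<close> is relatively closed in \<open>D\<close>.\<close>

text \<open>An infimum passes through the increasing power once the \<open>p\<close>-th root of the
  bound is taken. The case \<open>K \<le> 0\<close> is split off because root and power undo each
  other only on nonnegative numbers.\<close>

lemma le_infdist_powr:
  fixes x :: "'a::metric_space"
  assumes "S \<noteq> {}" "0 < p" "\<And>y. y \<in> S \<Longrightarrow> K \<le> dist x y powr p"
  shows "K \<le> infdist x S powr p"
proof (cases "K \<le> 0")
  case True
  then show ?thesis
    by (rule order_trans) simp
next
  case False
  then have K: "0 < K" by simp
  have "K powr (1 / p) \<le> dist x y" if "y \<in> S" for y
  proof -
    have "K powr (1 / p) \<le> (dist x y powr p) powr (1 / p)"
      using assms(2) assms(3)[OF that] K by (intro powr_mono2) auto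
    then show ?thesis
      using assms(2) by (simp add: powr_powr)
  qed
  then have "K powr (1 / p) \<le> infdist x S"
    unfolding infdist_notempty[OF assms(1)] by (intro cINF_greatest assms(1))
  then have "(K powr (1 / p)) powr p \<le> infdist x S powr p"
    using assms(2) by (intro powr_mono2) auto
  then show ?thesis
    using assms(2) K by (simp add: powr_powr)
qed

section \<open>Consequences of the hypotheses at fixed points\<close>

lemma psi_fixed_point:
  assumes "T y = y"
  shows "psi p c T x y = c / 2 * dist (T x) x powr p"
  using assms by (simp add: psi_def)

text \<open>By \<open>psi_fixed_point\<close> the infimum runs over a constant family, and the outer
  factor and root undo \<open>c / 2\<close> and the power.\<close>

lemma surrogate_fixed_points:
  assumes "S \<subseteq> fixed_points T" "S \<noteq> {}" "0 < p" "0 < c"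
  shows "surrogate p c T S x = dist (T x) x"
proof -
  have "(INF y\<in>S. psi p c T x y) = (INF y\<in>S. c / 2 * dist (T x) x powr p)"
    using assms(1) by (intro INF_cong) (auto simp: fixed_points_def psi_fixed_point)
  also have "\<dots> = c / 2 * dist (T x) x powr p"
    using assms(2) by simp
  finally have "surrogate p c T S x = (2 / c * (c / 2 * dist (T x) x powr p)) powr (1 / p)"
    unfolding surrogate_def by (rule arg_cong)
  then show ?thesis
    using assms(3,4) by (simp add: powr_powr)
qed

text \<open>Subregularity speaks only of points where the gauge value is positive. Strict
  monotonicity with \<open>\<rho> 0 = 0\<close> covers all non-fixed points; a fixed point of
  \<open>D\<close> is at distance 0.\<close>

lemma subregular_fixed_points_bound:
  assumes "fixed_points T \<inter> D \<noteq> {}" "0 < p" "0 < c" "gauge_function \<rho>"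
    and "metrically_subregular_for_0 (surrogate p c T (fixed_points T \<inter> D)) D \<rho>"
    and "x \<in> D"
  shows "infdist x (fixed_points T \<inter> D) \<le> \<rho> (dist (T x) x)"
proof (cases "T x = x")
  case True
  then show ?thesis
    using assms(4,6) by (simp add: gauge_function_def fixed_points_def)
next
  case False
  have sur: "surrogate p c T (fixed_points T \<inter> D) = (\<lambda>x. dist (T x) x)"
    using assms(1-3) by (intro ext surrogate_fixed_points) auto
  have "\<rho> 0 < \<rho> (dist (T x) x)"
    by (rule strict_mono_onD[of "{0..}"]) (use assms(4) False in \<open>auto simp: gauge_function_def\<close>)
  then have "0 < \<rho> (dist (T x) x)"
    using assms(4) by (simp add: gauge_function_def)
  moreover have "(\<lambda>x. dist (T x) x) -` {0} \<inter> D = fixed_points T \<inter> D"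
    by (auto simp: fixed_points_def)
  ultimately show ?thesis
    using assms(5,6) unfolding metrically_subregular_for_0_def sur by metis
qed

lemma firmly_nonexpansive_fixed_point:
  assumes "pointwise_firmly_nonexpansive p c \<alpha> T y D" "T y = y" "x \<in> D"
  shows "dist (T x) y powr p \<le> dist x y powr p - c * (1 - \<alpha>) / (2 * \<alpha>) * dist (T x) x powr p"
proof -
  have "dist (T x) (T y) powr p \<le> dist x y powr p - (1 - \<alpha>) / \<alpha> * psi p c T x y"
    using assms(1,3) by (auto simp: pointwise_firmly_nonexpansive_def)
  then show ?thesis
    by (simp add: assms(2) psi_fixed_point mult_ac)
qed

lemma firmly_nonexpansive_imp_quasi_nonexpansive:
  assumes "pointwise_firmly_nonexpansive p c \<alpha> T y D" "T y = y" "x \<in> D" "0 < p" "0 < c"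
  shows "dist (T x) y \<le> dist x y"
proof -
  have "0 < \<alpha>" "\<alpha> < 1"
    using assms(1) by (auto simp: pointwise_firmly_nonexpansive_def)
  then have "0 \<le> c * (1 - \<alpha>) / (2 * \<alpha>) * dist (T x) x powr p"
    using assms(5) by simp
  then have "dist (T x) y powr p \<le> dist x y powr p"
    using firmly_nonexpansive_fixed_point[OF assms(1-3)] by linarith
  then show ?thesis
    using assms(4) by (metis powr_less_mono2 not_le zero_le_dist)
qed

text \<open>The detour through \<open>y\<close> costs at most \<open>2 * dist x y\<close>; this is
  the origin of the factor 2 in the final rate.\<close>

lemma quasi_nonexpansive_dist_le:
  fixes T :: "'a::metric_space \<Rightarrow> 'a"
  assumes "S \<noteq> {}" "\<And>y. y \<in> S \<Longrightarrow> dist (T x) y \<le> dist x y"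
  shows "dist x (T x) \<le> 2 * infdist x S"
proof -
  have "dist x (T x) / 2 \<le> dist x y" if "y \<in> S" for y
    using assms(2)[OF that] dist_triangle2[of x "T x" y] by linarith
  then have "dist x (T x) / 2 \<le> infdist x S"
    unfolding infdist_notempty[OF assms(1)] by (intro cINF_greatest assms(1))
  then show ?thesis by simp
qed

section \<open>The relation between the two gauges\<close>

locale gauge_pair =
  fixes p \<tau> :: real and \<rho> \<theta> :: "real \<Rightarrow> real"
  assumes p_pos: "0 < p" and tau_pos: "0 < \<tau>"
    and gauge: "gauge_function \<rho>"
    and link: "\<And>t. 0 \<le> t \<Longrightarrow> \<rho> (((t powr p - \<theta> t powr p) / \<tau>) powr (1 / p)) = t"
    and theta_0: "\<theta> 0 = 0"
    and theta_pos: "\<And>t. 0 < t \<Longrightarrow> 0 < \<theta> t"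
    and theta_less: "\<And>t. 0 < t \<Longrightarrow> \<theta> t < t"
begin

text \<open>This is the inverse of \<open>\<rho>\<close> on \<open>{0..}\<close>, written through
  \<open>\<theta>\<close>; \<open>theta_eq\<close> is then the second half of the equivalence
  linking the gauges.\<close>

definition \<sigma> :: "real \<Rightarrow> real" where
  "\<sigma> t = ((t powr p - \<theta> t powr p) / \<tau>) powr (1 / p)"

lemma theta_nonneg: "0 \<le> t \<Longrightarrow> 0 \<le> \<theta> t"
  using theta_0 theta_pos[of t] by (cases "t = 0") auto

lemma theta_le: "0 \<le> t \<Longrightarrow> \<theta> t \<le> t"
  using theta_0 theta_less[of t] by (cases "t = 0") auto

lemma sigma_nonneg: "0 \<le> \<sigma> t"
  by (simp add: \<sigma>_def)

lemma rho_sigma: "0 \<le> t \<Longrightarrow> \<rho> (\<sigma> t) = t"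
  by (simp add: \<sigma>_def link)

lemma sigma_powr:
  assumes "0 \<le> t"
  shows "\<tau> * \<sigma> t powr p = t powr p - \<theta> t powr p"
proof -
  have "\<theta> t powr p \<le> t powr p"
    using assms p_pos theta_nonneg theta_le by (intro powr_mono2) auto
  then show ?thesis
    using p_pos tau_pos by (simp add: \<sigma>_def powr_powr)
qed

lemma theta_eq:
  assumes "0 \<le> t"
  shows "\<theta> t = (t powr p - \<tau> * \<sigma> t powr p) powr (1 / p)"
  using theta_nonneg[OF assms] p_pos by (simp add: sigma_powr[OF assms] powr_powr)

lemma rho_less_iff: "0 \<le> a \<Longrightarrow> 0 \<le> b \<Longrightarrow> \<rho> a < \<rho> b \<longleftrightarrow> a < b"
  using gauge unfolding gauge_function_def by (meson atLeast_iff strict_mono_on_less)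

text \<open>Order argument: for \<open>a\<close> and \<open>u\<close> nonnegative,
  \<open>a < \<sigma> u\<close> iff \<open>\<rho> a < u\<close>, and likewise for \<open>>\<close>,
  so preimages of rays are rays.\<close>

lemma continuous_on_sigma: "continuous_on {0..} \<sigma>"
  unfolding continuous_on_def
proof (intro ballI order_tendstoI)
  fix t a :: real
  assume t: "t \<in> {0..}" and a: "a < \<sigma> t"
  show "\<forall>\<^sub>F u in at t within {0..}. a < \<sigma> u"
  proof (cases "a < 0")
    case True
    then show ?thesis
      using sigma_nonneg by (auto intro!: always_eventually less_le_trans[of a 0])
  next
    case False
    then have "\<rho> a < t"
      using a t rho_less_iff[of a "\<sigma> t"] by (simp add: rho_sigma)
    then have "\<forall>\<^sub>F u in at t within {0..}. \<rho> a < u"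
      by (rule order_tendstoD[OF tendsto_ident_at])
    moreover have "\<forall>\<^sub>F u in at t within {0..}. 0 \<le> u"
      by (simp add: eventually_at_filter)
    ultimately show ?thesis
    proof eventually_elim
      case (elim u)
      then show ?case
        using False rho_less_iff[of a "\<sigma> u"] by (simp add: sigma_nonneg rho_sigma)
    qed
  qed
next
  fix t b :: real
  assume t: "t \<in> {0..}" and b: "\<sigma> t < b"
  have b0: "0 \<le> b"
    using b sigma_nonneg[of t] by simp
  then have "t < \<rho> b"
    using b t rho_less_iff[of "\<sigma> t" b] by (simp add: rho_sigma sigma_nonneg)
  then have "\<forall>\<^sub>F u in at t within {0..}. u < \<rho> b"
    by (rule order_tendstoD[OF tendsto_ident_at])
  moreover have "\<forall>\<^sub>F u in at t within {0..}. 0 \<le> u"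
    by (simp add: eventually_at_filter)
  ultimately show "\<forall>\<^sub>F u in at t within {0..}. \<sigma> u < b"
  proof eventually_elim
    case (elim u)
    then show ?case
      using b0 rho_less_iff[of "\<sigma> u" b] by (simp add: sigma_nonneg rho_sigma)
  qed
qed

text \<open>A gauge monotone rate must be continuous; \<open>\<theta>\<close> inherits this from
  \<open>\<sigma>\<close> through \<open>theta_eq\<close>.\<close>

lemma continuous_on_theta: "continuous_on {0..} \<theta>"
proof -
  have "continuous_on {0..} (\<lambda>t. t powr p - \<tau> * \<sigma> t powr p)"
    using p_pos sigma_nonneg continuous_on_sigma
    by (intro continuous_on_diff continuous_on_mult continuous_on_powr' continuous_on_const
        continuous_on_id) auto
  moreover have "0 \<le> t powr p - \<tau> * \<sigma> t powr p" if "0 \<le> t" for t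
    by (simp add: sigma_powr[OF that])
  ultimately have "continuous_on {0..} (\<lambda>t. (t powr p - \<tau> * \<sigma> t powr p) powr (1 / p))"
    using p_pos by (intro continuous_on_powr' continuous_on_const) auto
  then show ?thesis
    by (rule continuous_on_eq) (simp add: theta_eq)
qed

lemma infdist_image_le:
  fixes T :: "'a::metric_space \<Rightarrow> 'a"
  assumes "S \<noteq> {}" and subreg: "infdist x S \<le> \<rho> (dist (T x) x)"
    and firm: "\<And>y. y \<in> S \<Longrightarrow> dist (T x) y powr p \<le> dist x y powr p - \<tau> * dist (T x) x powr p"
  shows "infdist (T x) S \<le> \<theta> (infdist x S)"
proof -
  define t where "t = infdist x S"
  have t: "0 \<le> t"
    by (simp add: t_def infdist_nonneg)
  \<comment> \<open>Otherwise \<open>\<rho> (dist (T x) x) < \<rho> (\<sigma> t) = t\<close>,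
    against subregularity.\<close>
  have "\<sigma> t \<le> dist (T x) x"
    using subreg rho_less_iff[of "dist (T x) x" "\<sigma> t"] t
    by (simp add: sigma_nonneg rho_sigma flip: t_def)
  then have "\<sigma> t powr p \<le> dist (T x) x powr p"
    using p_pos sigma_nonneg by (intro powr_mono2) auto
  then have *: "t powr p - \<theta> t powr p \<le> \<tau> * dist (T x) x powr p"
    using tau_pos by (simp flip: sigma_powr[OF t])
  \<comment> \<open>The left side is free of \<open>y\<close>, so the infimum affects only
    \<open>dist x y\<close>; it yields \<open>t powr p\<close>, which cancels.\<close>
  have "infdist (T x) S powr p + t powr p - \<theta> t powr p \<le> infdist x S powr p"
  proof (rule le_infdist_powr[OF assms(1) p_pos])
    fix y assume y: "y \<in> S"
    have "infdist (T x) S powr p \<le> dist (T x) y powr p"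
      using p_pos y by (intro powr_mono2 infdist_le) (auto simp: infdist_nonneg)
    then show "infdist (T x) S powr p + t powr p - \<theta> t powr p \<le> dist x y powr p"
      using firm[OF y] * by linarith
  qed
  then have "infdist (T x) S powr p \<le> \<theta> t powr p"
    by (simp add: t_def)
  then have "infdist (T x) S \<le> \<theta> t"
    using p_pos theta_nonneg[OF t] by (metis powr_less_mono2 not_le)
  then show ?thesis
    by (simp add: t_def)
qed

end

section \<open>Iteration and convergence\<close>

lemma infdist_le_funpow:
  assumes "mono_on {0..} \<theta>" "\<And>t. 0 \<le> t \<Longrightarrow> 0 \<le> \<theta> t"
    and "\<And>k. infdist (x (Suc k)) S \<le> \<theta> (infdist (x k) S)"
  shows "infdist (x k) S \<le> (\<theta> ^^ k) (infdist (x 0) S)"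
proof (induction k)
  case (Suc k)
  have "infdist (x (Suc k)) S \<le> \<theta> (infdist (x k) S)"
    by (rule assms(3))
  also have "\<dots> \<le> \<theta> ((\<theta> ^^ k) (infdist (x 0) S))"
    using Suc infdist_nonneg[of "x k" S] by (intro mono_onD[OF assms(1)]) auto
  finally show ?case by simp
qed simp

text \<open>The bound is uniform in \<open>m\<close>, so it survives letting \<open>m\<close> run
  along a convergent subsequence.\<close>

lemma dist_le_suminf_tail:
  fixes x :: "nat \<Rightarrow> 'a::metric_space"
  assumes "summable b" "\<And>j. dist (x j) (x (Suc j)) \<le> b j" "k \<le> m"
  shows "dist (x k) (x m) \<le> (\<Sum>j. b (k + j))"
proof -
  have nonneg: "0 \<le> b j" for j
    by (rule order_trans[OF zero_le_dist assms(2)])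
  have "dist (x k) (x (k + n)) \<le> (\<Sum>j<n. b (k + j))" for n
  proof (induction n)
    case (Suc n)
    then show ?case
      using assms(2)[of "k + n"] dist_triangle[of "x k" "x (k + Suc n)" "x (k + n)"] by simp
  qed simp
  from this[of "m - k"] have "dist (x k) (x m) \<le> (\<Sum>j<m - k. b (k + j))"
    using assms(3) by simp
  also have "\<dots> \<le> (\<Sum>j. b (k + j))"
    using summable_ignore_initial_segment[OF assms(1), of k] nonneg
    by (intro sum_le_suminf) (simp_all only: add.commute[of k] finite_lessThan)
  finally show ?thesis .
qed

text \<open>Quasi-nonexpansiveness replaces continuity of \<open>T\<close> in showing that limits of
  points of \<open>S\<close> are fixed.\<close>

lemma fixed_point_of_infdist_eq_0:
  fixes T :: "'a::metric_space \<Rightarrow> 'a"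
  assumes "S \<noteq> {}" "\<And>y. y \<in> S \<Longrightarrow> dist (T x) y \<le> dist x y" "infdist x S = 0"
  shows "T x = x"
proof -
  have "dist x (T x) \<le> 2 * infdist x S"
    using assms(1,2) by (rule quasi_nonexpansive_dist_le)
  then show ?thesis
    using assms(3) by simp
qed

text \<open>The relation between the gauges does not force \<open>\<theta>\<close> to increase,
  while a gauge monotone rate must; hence the premise \<open>strict_mono_on\<close> in the second
  claim. Monotonicity also lets the one-step estimate be iterated.\<close>

theorem theorem30:
  fixes G D S :: "'a::metric_space set"
    and T :: "'a \<Rightarrow> 'a"
    and p c \<alpha> \<tau> :: real
    and \<rho> \<theta> :: "real \<Rightarrow> real"
    and x :: "nat \<Rightarrow> 'a"
  defines "S \<equiv> fixed_points T \<inter> D"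
    and "\<tau> \<equiv> c * (1 - \<alpha>) / (2 * \<alpha>)"
  assumes "1 < p" and "0 < c" and "p_uniformly_convex G p c"
    and "D \<subseteq> G" and "T ` G \<subseteq> G"
    and "T ` D \<subseteq> D" and "boundedly_compact (T ` D)"
    and "S \<noteq> {}"
    and "0 < \<alpha>" and "\<alpha> < 1"
    and "\<forall>y\<in>S. pointwise_firmly_nonexpansive p c \<alpha> T y D"
    and "gauge_function \<rho>"
    and "metrically_subregular_for_0 (surrogate p c T S) D \<rho>"
    and "\<forall>t\<ge>0. \<rho> (((t powr p - \<theta> t powr p) / \<tau>) powr (1 / p)) = t"
    and "\<theta> 0 = 0" and "\<forall>t>0. 0 < \<theta> t \<and> \<theta> t < t"
    and "\<forall>t\<ge>0. summable (\<lambda>j. (\<theta> ^^ Suc j) t)"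
    and "x 0 \<in> D" and "\<forall>k. x (Suc k) = T (x k)"
  shows "(\<forall>k. infdist (x (Suc k)) S \<le> \<theta> (infdist (x k) S)) \<and>
         (strict_mono_on {0..} \<theta> \<longrightarrow>
           (\<exists>xstar\<in>S. converges_gauge_monotonically x xstar S \<theta> (infdist (x 0) S)))"
proof -
  have p: "0 < p" and \<tau>: "0 < \<tau>"
    using \<open>1 < p\<close> \<open>0 < c\<close> \<open>0 < \<alpha>\<close> \<open>\<alpha> < 1\<close> by (simp_all add: \<tau>_def)
  interpret gauge_pair p \<tau> \<rho> \<theta>
  proof
    show "\<rho> (((t powr p - \<theta> t powr p) / \<tau>) powr (1 / p)) = t" if "0 \<le> t" for t
      using that \<open>\<forall>t\<ge>0. \<rho> _ = t\<close> by blast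
  qed (use p \<tau> \<open>gauge_function \<rho>\<close> \<open>\<theta> 0 = 0\<close> \<open>\<forall>t>0. 0 < \<theta> t \<and> \<theta> t < t\<close> in auto)
  have xD: "x k \<in> D" for k
    using \<open>x 0 \<in> D\<close> \<open>\<forall>k. x (Suc k) = T (x k)\<close> \<open>T ` D \<subseteq> D\<close> by (induction k) auto
  have xT: "x (Suc k) = T (x k)" for k
    using \<open>\<forall>k. x (Suc k) = T (x k)\<close> by simp
  have S: "T y = y" "pointwise_firmly_nonexpansive p c \<alpha> T y D" if "y \<in> S" for y
    using that \<open>\<forall>y\<in>S. pointwise_firmly_nonexpansive p c \<alpha> T y D\<close>
    by (auto simp: S_def fixed_points_def)
  have quasi: "dist (T z) y \<le> dist z y" if "z \<in> D" "y \<in> S" for z y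
    using firmly_nonexpansive_imp_quasi_nonexpansive S that p \<open>0 < c\<close> by blast
  have step: "infdist (x (Suc k)) S \<le> \<theta> (infdist (x k) S)" for k
    unfolding xT
  proof (rule infdist_image_le)
    show "infdist (x k) S \<le> \<rho> (dist (T (x k)) (x k))"
      using \<open>S \<noteq> {}\<close> p \<open>0 < c\<close> \<open>gauge_function \<rho>\<close>
        \<open>metrically_subregular_for_0 (surrogate p c T S) D \<rho>\<close> xD
      unfolding S_def by (rule subregular_fixed_points_bound)
    show "dist (T (x k)) y powr p \<le> dist (x k) y powr p - \<tau> * dist (T (x k)) (x k) powr p"
      if "y \<in> S" for y
      unfolding \<tau>_def using S that xD by (intro firmly_nonexpansive_fixed_point) auto
  qed (rule \<open>S \<noteq> {}\<close>)
  moreover have "\<exists>xstar\<in>S. converges_gauge_monotonically x xstar S \<theta> (infdist (x 0) S)"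
    if mono: "strict_mono_on {0..} \<theta>"
  proof -
    define b where "b j = 2 * (\<theta> ^^ j) (infdist (x 0) S)" for j
    \<comment> \<open>The hypothesis starts at the first iterate; here the term \<open>j = 0\<close>
      is added.\<close>
    have sum_theta: "summable (\<lambda>j. (\<theta> ^^ j) (infdist (x 0) S))"
      using \<open>\<forall>t\<ge>0. summable (\<lambda>j. (\<theta> ^^ Suc j) t)\<close> infdist_nonneg[of "x 0" S]
      by (subst summable_Suc_iff[symmetric]) blast
    then have sum_b: "summable b"
      unfolding b_def by (rule summable_mult)
    have inf_le: "infdist (x k) S \<le> (\<theta> ^^ k) (infdist (x 0) S)" for k
      using strict_mono_on_imp_mono_on[OF mono] theta_nonneg step by (rule infdist_le_funpow)
    have "dist (x j) (T (x j)) \<le> 2 * infdist (x j) S" for j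
      using \<open>S \<noteq> {}\<close> quasi[OF xD] by (rule quasi_nonexpansive_dist_le)
    then have "dist (x j) (x (Suc j)) \<le> b j" for j
      using inf_le[of j] by (smt (verit) b_def xT)
    then have dist_tail: "dist (x k) (x m) \<le> (\<Sum>j. b (k + j))" if "k \<le> m" for k m
      using dist_le_suminf_tail[OF sum_b _ that] by blast
    have "range (\<lambda>k. x (Suc k)) \<subseteq> cball (x 0) (\<Sum>j. b (0 + j))"
      using dist_tail[of 0] by auto
    then have "bounded (range (\<lambda>k. x (Suc k)))"
      using bounded_cball bounded_subset by blast
    moreover have "range (\<lambda>k. x (Suc k)) \<subseteq> T ` D"
      using xD by (auto simp: xT)
    ultimately obtain l r where l: "l \<in> T ` D" and r: "strict_mono r"
      and "((\<lambda>k. x (Suc k)) \<circ> r) \<longlonglongrightarrow> l"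
      using \<open>boundedly_compact (T ` D)\<close> unfolding boundedly_compact_def by metis
    then have lim: "(\<lambda>n. x (Suc (r n))) \<longlonglongrightarrow> l"
      by (simp add: o_def)
    have lD: "l \<in> D"
      using l \<open>T ` D \<subseteq> D\<close> by auto
    have "(\<lambda>n. infdist (x n) S) \<longlonglongrightarrow> 0"
      by (rule tendsto_sandwich[OF _ _ tendsto_const summable_LIMSEQ_zero[OF sum_theta]])
        (auto simp: infdist_nonneg inf_le)
    moreover have "strict_mono (\<lambda>n. Suc (r n))"
      using r by (simp add: strict_mono_def)
    ultimately have "(\<lambda>n. infdist (x (Suc (r n))) S) \<longlonglongrightarrow> 0"
      using LIMSEQ_subseq_LIMSEQ by (fastforce simp: o_def)
    with tendsto_infdist[OF lim] have "infdist l S = 0"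
      using LIMSEQ_unique by blast
    with \<open>S \<noteq> {}\<close> quasi[OF lD] have "T l = l"
      by (rule fixed_point_of_infdist_eq_0)
    then have lS: "l \<in> S"
      using lD by (simp add: S_def fixed_points_def)
    have "dist (x k) l \<le> 2 * tail_sum \<theta> k (infdist (x 0) S)" for k
    proof -
      have "dist (x k) l \<le> (\<Sum>j. b (k + j))"
      \<comment> \<open>For \<open>n \<ge> k\<close> the index \<open>Suc (r n)\<close> exceeds
        \<open>k\<close>, so the tail bound applies before the limit. The whole sequence thus
        converges to the cluster point.\<close>
      proof (rule LIMSEQ_le_const2[OF tendsto_dist[OF tendsto_const lim]], intro exI allI impI)
        fix n assume "k \<le> n"
        then show "dist (x k) (x (Suc (r n))) \<le> (\<Sum>j. b (k + j))"
          using seq_suble[OF r, of n] by (intro dist_tail) linarith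
      qed
      also have "\<dots> = 2 * tail_sum \<theta> k (infdist (x 0) S)"
        unfolding b_def tail_sum_def
        using summable_ignore_initial_segment[OF sum_theta, of k]
        by (intro suminf_mult) (simp only: add.commute[of k])
      finally show ?thesis .
    qed
    moreover have "gauge_monotone x S \<theta>"
      using \<open>S \<noteq> {}\<close> continuous_on_theta theta_0 theta_le step mono
      by (auto simp: gauge_monotone_def strict_mono_on_def)
    ultimately have "converges_gauge_monotonically x l S \<theta> (infdist (x 0) S)"
      using \<open>\<forall>t\<ge>0. summable (\<lambda>j. (\<theta> ^^ Suc j) t)\<close>
      unfolding converges_gauge_monotonically_def by (intro conjI exI[of _ 2]) auto
    then show ?thesis
      using lS by blast
  qed
  ultimately show ?thesis
    by blast
qed

end
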